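(* Let $\mathcal{A}$ be the algebra of (generally square-matrix-valued) functions $F[u]$ on the jet space described in the context, with total derivatives $D_i$. Let $\Delta_1$ and $\Delta_2$ be characteristic derivatives with characteristics $Q_1[u],Q_2[u]\in\mathcal{A}$, respectively, so that $\Delta_1u=Q_1[u]$ and $\Delta_2u=Q_2[u]$. Define the operator $\Delta_1+\Delta_2$ on $\mathcal{A}$ by $(\Delta_1+\Delta_2)F[u]:=\Delta_1F[u]+\Delta_2F[u]$. Then $\Delta_1+\Delta_2$ is a characteristic derivative with characteristic $Q_1[u]+Q_2[u]$; that is, $\Delta_1+\Delta_2=\Delta_Q$ with $Q[u]=Q_1[u]+Q_2[u]$.
   Context: Jet-space functions. Let $x^1,x^2,\ldots$ be scalar independent variables (collectively $x^k$), and let $u$ be a dependent variable, together with its formal partial derivatives $u_i$, $u_{ij}$, $u_{ijk},\ldots$ (symmetric in their indices). All of these are square-matrix-valued of one fixed size, in general non-commuting, with entries in $\mathbb{K}=\mathbb{R}$ or $\mathbb{C}$; the scalar case is size $1$. $\mathcal{A}$ is the (generally non-commutative) associative $\mathbb{K}$-algebra of functions of the form $F[u]=\sum a(x^k)\,\Pi[u]\,b(x^k)\,\Pi'[u]\,c(x^k)\cdots$, a finite or infinite sum, where $a,b,c,\ldots$ are (generally matrix-valued) functions of the $x^k$ only ("functions in the base space") and $\Pi[u],\Pi'[u],\ldots$ are products of powers of the variables $u,u_i,u_{ij},\ldots$. Total derivatives. $D_i$ is the linear operator on $\mathcal{A}$ such that $D_i f(x^k)=\partial f/\partial x^i$ for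 base-space functions $f$; $D_i u=u_i$, $D_i u_j=D_j u_i=u_{ij}=u_{ji}$, and so on for higher derivatives; and $D_i(FG)=(D_iF)G+F\,D_iG$ for all $F,G\in\mathcal{A}$. Total derivatives commute with each other. Characteristic derivatives. For $Q[u]\in\mathcal{A}$, a characteristic derivative with characteristic $Q[u]$ is a linear operator $\Delta_Q:\mathcal{A}\to\mathcal{A}$ such that: (1) $\Delta_Q f(x^k)=0$ for every base-space function $f$; (2) $\Delta_Q u=Q[u]$; (3) $\Delta_Q D_i=D_i\Delta_Q$ for all $i$; (4) $\Delta_Q(FG)=(\Delta_QF)G+F\,\Delta_QG$ for all $F,G\in\mathcal{A}$. Standing convention: $\Delta_Q$ is uniquely determined by its action on $u$, i.e. by $Q$ (operators act term by term on the sums defining $\mathcal{A}$). *)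

theory Defs
  imports "HOL-Analysis.Analysis" "HOL-Library.Function_Algebras" "HOL-Library.Multiset"
begin

(* The scalars 'k range over the class real_normed_field; by the Gelfand-Mazur theorem its
   members are, up to isomorphism, exactly the real and the complex numbers.
   The independent variables x^i are indexed by a countable type 'i (finite or not), and 'n
   indexes the rows and the columns of the square matrices. *)

type_synonym ('i, 'k, 'n) base_fun = "('i \<Rightarrow> 'k) \<Rightarrow> 'k ^ 'n ^ 'n"

definition partial ::
  "'i \<Rightarrow> ('i, 'k::real_normed_field, 'n::finite) base_fun \<Rightarrow> ('i, 'k, 'n) base_fun" where
  "partial i f = (\<lambda>x. \<chi> a b. deriv (\<lambda>t. f (x(i := t)) $ a $ b) (x i))"

(* All iterated partial derivatives exist and are continuous, where 'i => 'k carries the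
   product topology. *)
definition smooth :: "('i, 'k::real_normed_field, 'n::finite) base_fun \<Rightarrow> bool" where
  "smooth f \<longleftrightarrow> (\<forall>is. continuous_on UNIV (foldr partial is f) \<and>
     (\<forall>i x a b. (\<lambda>t. foldr partial is f (x(i := t)) $ a $ b) field_differentiable (at (x i))))"

(* A multi-index is a multiset of variable indices, so the derivatives u_J of u are symmetric in
   their indices by construction; the empty multiset stands for u itself.
   A scalar coordinate of the jet space is a matrix entry (J, a, b) of u_J.  A jet function is
   a matrix-valued power series in these commuting scalar coordinates, given by its coefficients,
   which are matrix-valued functions on the base space.  Thus u_J is the matrix of the coordinates
   (J, a, b), two such matrices do not commute unless the matrix size is 1, and infinite sums make
   sense without any choice of a domain of convergence. *)
type_synonym ('i, 'n) jet_coord = "'i multiset \<times> 'n \<times> 'n"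
type_synonym ('i, 'k, 'n) jet_fun = "('i, 'n) jet_coord multiset \<Rightarrow> ('i, 'k, 'n) base_fun"

definition jet_base ::
  "('i, 'k::real_normed_field, 'n::finite) base_fun \<Rightarrow> ('i, 'k, 'n) jet_fun" where
  "jet_base f = (\<lambda>m. if m = {#} then f else 0)"

definition jet_var :: "'i multiset \<Rightarrow> ('i, 'k::real_normed_field, 'n::finite) jet_fun" where
  "jet_var J = (\<lambda>m x. \<chi> a b. if m = {#(J, a, b)#} then 1 else 0)"

(* Sums of jet functions are pointwise (Function_Algebras); products are Cauchy products, not
   the pointwise product of Function_Algebras. *)
definition jet_mult :: "('i, 'k::real_normed_field, 'n::finite) jet_fun \<Rightarrow>
    ('i, 'k, 'n) jet_fun \<Rightarrow> ('i, 'k, 'n) jet_fun" (infixl "\<star>" 70) where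
  "F \<star> G = (\<lambda>m x. \<Sum>p | p \<subseteq># m. F p x ** G (m - p) x)"

definition jet_scale :: "'k::real_normed_field \<Rightarrow> ('i, 'k, 'n::finite) jet_fun \<Rightarrow>
    ('i, 'k, 'n) jet_fun" where
  "jet_scale c F = (\<lambda>m x. \<chi> a b. c * F m x $ a $ b)"

definition jet_sums :: "(nat \<Rightarrow> ('i, 'k::real_normed_field, 'n::finite) jet_fun) \<Rightarrow>
    ('i, 'k, 'n) jet_fun \<Rightarrow> bool" where
  "jet_sums T F \<longleftrightarrow>
     (\<forall>m. finite {n. T n m \<noteq> 0} \<and> F m = (\<Sum>n | T n m \<noteq> 0. T n m))"

(* The summands a(x) Pi[u] b(x) Pi'[u] c(x) ..., with the u_J restricted to J in V. *)
inductive_set jet_terms ::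
  "'i multiset set \<Rightarrow> ('i, 'k::real_normed_field, 'n::finite) jet_fun set"
  for V :: "'i multiset set" where
  base: "smooth f \<Longrightarrow> jet_base f \<in> jet_terms V"
| var: "J \<in> V \<Longrightarrow> jet_var J \<in> jet_terms V"
| mult: "F \<in> jet_terms V \<Longrightarrow> G \<in> jet_terms V \<Longrightarrow> F \<star> G \<in> jet_terms V"

(* The summands of a defining sum involve only derivatives u_J with J in one common member V of
   the collection VV.  VV = UNIV means that every sum is admitted; VV = Collect finite means
   that each function involves finitely many derivatives of u only.
   Finite sums are included, since the constant function 0 is a term. *)
definition jet_series :: "'i multiset set set \<Rightarrow>
    (nat \<Rightarrow> ('i, 'k::real_normed_field, 'n::finite) jet_fun) set" where
  "jet_series VV = {T. \<exists>V\<in>VV. \<forall>n. T n \<in> jet_terms V}"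

definition jet_algebra :: "'i multiset set set \<Rightarrow>
    ('i, 'k::real_normed_field, 'n::finite) jet_fun set" where
  "jet_algebra VV = {F. \<exists>T \<in> jet_series VV. jet_sums T F}"

type_synonym ('i, 'k, 'n) jet_op = "('i, 'k, 'n) jet_fun \<Rightarrow> ('i, 'k, 'n) jet_fun"

definition linear_operator ::
  "'i multiset set set \<Rightarrow> ('i, 'k::real_normed_field, 'n::finite) jet_op \<Rightarrow> bool" where
  "linear_operator VV L \<longleftrightarrow>
     (\<forall>F\<in>jet_algebra VV. L F \<in> jet_algebra VV) \<and>
     (\<forall>F\<in>jet_algebra VV. \<forall>G\<in>jet_algebra VV. L (F + G) = L F + L G) \<and>
     (\<forall>c. \<forall>F\<in>jet_algebra VV. L (jet_scale c F) = jet_scale c (L F))"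

definition acts_termwise ::
  "'i multiset set set \<Rightarrow> ('i, 'k::real_normed_field, 'n::finite) jet_op \<Rightarrow> bool" where
  "acts_termwise VV L \<longleftrightarrow>
     (\<forall>T\<in>jet_series VV. \<forall>F. jet_sums T F \<longrightarrow> jet_sums (\<lambda>n. L (T n)) (L F))"

definition leibniz ::
  "'i multiset set set \<Rightarrow> ('i, 'k::real_normed_field, 'n::finite) jet_op \<Rightarrow> bool" where
  "leibniz VV L \<longleftrightarrow>
     (\<forall>F\<in>jet_algebra VV. \<forall>G\<in>jet_algebra VV. L (F \<star> G) = L F \<star> G + F \<star> L G)"

definition total_derivative :: "'i multiset set set \<Rightarrow> 'i \<Rightarrow>
    ('i, 'k::real_normed_field, 'n::finite) jet_op \<Rightarrow> bool" where
  "total_derivative VV i D \<longleftrightarrow>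
     linear_operator VV D \<and> acts_termwise VV D \<and>
     (\<forall>f. smooth f \<longrightarrow> D (jet_base f) = jet_base (partial i f)) \<and>
     (\<forall>J. D (jet_var J) = jet_var (add_mset i J)) \<and>
     leibniz VV D"

definition characteristic_derivative :: "'i multiset set set \<Rightarrow>
    ('i \<Rightarrow> ('i, 'k::real_normed_field, 'n::finite) jet_op) \<Rightarrow>
    ('i, 'k, 'n) jet_fun \<Rightarrow> ('i, 'k, 'n) jet_op \<Rightarrow> bool" where
  "characteristic_derivative VV D Q \<Delta> \<longleftrightarrow>
     linear_operator VV \<Delta> \<and> acts_termwise VV \<Delta> \<and>
     (\<forall>f. smooth f \<longrightarrow> \<Delta> (jet_base f) = 0) \<and>
     \<Delta> (jet_var {#}) = Q \<and>
     (\<forall>i. \<forall>F\<in>jet_algebra VV. \<Delta> (D i F) = D i (\<Delta> F)) \<and>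
     leibniz VV \<Delta>"

end

theory Submission imports Defs begin

text \<open>
  Closure of the conditions under addition is a direct verification; the algebra is closed under
  sums because two series can be interleaved. For uniqueness, the commutation with the total
  derivatives propagates the action on \<open>u\<close> to every \<open>u\<^sub>J\<close>, the Leibniz rule
  propagates it to every term, and termwise action propagates it to every series.
\<close>

lemma jet_mult_add_left: "(F + G) \<star> H = F \<star> H + G \<star> H"
  by (simp add: jet_mult_def fun_eq_iff vec_eq_iff matrix_matrix_mult_def distrib_right sum.distrib)

lemma jet_mult_add_right: "F \<star> (G + H) = F \<star> G + F \<star> H"
  by (simp add: jet_mult_def fun_eq_iff matrix_add_ldistrib sum.distrib)

lemma jet_scale_add: "jet_scale c (F + G) = jet_scale c F + jet_scale c G"
  by (simp add: jet_scale_def fun_eq_iff vec_eq_iff algebra_simps)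

lemma partial_zero: "partial i (\<lambda>x. 0) = (\<lambda>x. 0)"
  by (simp add: partial_def fun_eq_iff vec_eq_iff)

lemma smooth_zero: "smooth 0"
proof -
  have "foldr partial is (\<lambda>x. 0) = ((\<lambda>x. 0) :: ('a, 'b, 'c) base_fun)" for "is"
    by (induction "is") (simp_all add: partial_zero)
  then show ?thesis
    by (simp add: smooth_def zero_fun_def)
qed

text \<open>Series are indexed by all natural numbers, so finite and interleaved sums have to be
  padded with \<open>0\<close>.\<close>

lemma zero_in_jet_terms: "0 \<in> jet_terms V"
proof -
  have "jet_base 0 = 0"
    by (simp add: jet_base_def fun_eq_iff)
  then show ?thesis
    using jet_terms.base[OF smooth_zero] by metis
qed

lemma jet_terms_mono:
  assumes "F \<in> jet_terms V" "V \<subseteq> W"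
  shows "F \<in> jet_terms W"
  using assms by (induction rule: jet_terms.induct) (auto intro: jet_terms.intros)

lemma jet_sums_unique: "jet_sums T F \<Longrightarrow> jet_sums T G \<Longrightarrow> F = G"
  by (simp add: jet_sums_def fun_eq_iff)

lemma jet_sums_add:
  assumes "jet_sums S F" "jet_sums T G"
  shows "jet_sums (\<lambda>n. S n + T n) (F + G)"
  unfolding jet_sums_def
proof (intro allI conjI)
  fix m
  let ?A = "{n. S n m \<noteq> 0}" and ?B = "{n. T n m \<noteq> 0}" and ?C = "{n. (S n + T n) m \<noteq> 0}"
  have fin: "finite ?A" "finite ?B"
    and sums: "F m = (\<Sum>n\<in>?A. S n m)" "G m = (\<Sum>n\<in>?B. T n m)"
    using assms by (auto simp: jet_sums_def)
  \<comment> \<open>The inclusion can be strict, since \<open>S n m\<close> and \<open>T n m\<close>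
    may cancel; all sums are therefore compared over \<open>?A \<union> ?B\<close>.\<close>
  have sub: "?C \<subseteq> ?A \<union> ?B"
    by auto
  then show "finite ?C"
    by (rule finite_subset) (use fin in simp)
  have "F m = (\<Sum>n\<in>?A \<union> ?B. S n m)" "G m = (\<Sum>n\<in>?A \<union> ?B. T n m)"
    unfolding sums by (rule sum.mono_neutral_left; use fin in auto)+
  then have "(F + G) m = (\<Sum>n\<in>?A \<union> ?B. (S n + T n) m)"
    by (simp add: sum.distrib)
  also have "\<dots> = (\<Sum>n\<in>?C. (S n + T n) m)"
    by (rule sum.mono_neutral_right) (use fin sub in auto)
  finally show "(F + G) m = (\<Sum>n\<in>?C. (S n + T n) m)" .
qed

text \<open>At each \<open>m\<close>, the injection \<open>h\<close> carries the nonzero positions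
  of \<open>T\<close> bijectively onto those of \<open>S\<close>. This serves to spread a series
  over the even or the odd positions.\<close>

lemma jet_sums_reindex:
  assumes "jet_sums T F" "inj h" "\<And>n. S (h n) = T n" "\<And>n. n \<notin> range h \<Longrightarrow> S n = 0"
  shows "jet_sums S F"
  unfolding jet_sums_def
proof (intro allI conjI)
  fix m
  have eq: "{n. S n m \<noteq> 0} = h ` {n. T n m \<noteq> 0}"
  proof (intro equalityI subsetI)
    fix n assume "n \<in> {n. S n m \<noteq> 0}"
    then show "n \<in> h ` {n. T n m \<noteq> 0}"
      using assms(3,4) by (cases "n \<in> range h") auto
  qed (use assms(3) in auto)
  have inj: "inj_on h {n. T n m \<noteq> 0}"
    using assms(2) by (rule inj_on_subset) simp
  show "finite {n. S n m \<noteq> 0}"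
    using assms(1) by (simp add: eq jet_sums_def)
  show "F m = (\<Sum>n | S n m \<noteq> 0. S n m)"
    using assms(1,3) by (simp add: eq jet_sums_def sum.reindex[OF inj])
qed

lemma jet_algebra_add:
  assumes VV: "\<And>V W. V \<in> VV \<Longrightarrow> W \<in> VV \<Longrightarrow> V \<union> W \<in> VV"
    and "F \<in> jet_algebra VV" "G \<in> jet_algebra VV"
  shows "F + G \<in> jet_algebra VV"
proof -
  obtain S T V W where S: "\<And>n. S n \<in> jet_terms V" "jet_sums S F"
    and T: "\<And>n. T n \<in> jet_terms W" "jet_sums T G" and "V \<in> VV" "W \<in> VV"
    using assms(2,3) unfolding jet_algebra_def jet_series_def by blast
  \<comment> \<open>The rules of \<open>jet_terms\<close> provide no sums, so
    \<open>S n + T n\<close> need not be a term. After interleaving, one summand of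
    \<open>S' n + T' n\<close> is always \<open>0\<close>.\<close>
  define S' where "S' n = (if even n then S (n div 2) else 0)" for n
  define T' where "T' n = (if even n then 0 else T (n div 2))" for n
  have "jet_sums S' F"
    by (rule jet_sums_reindex[OF S(2), of "\<lambda>n. 2 * n"]) (auto simp: S'_def inj_def elim!: evenE)
  moreover have "jet_sums T' G"
    by (rule jet_sums_reindex[OF T(2), of "\<lambda>n. 2 * n + 1"])
      (auto simp: T'_def inj_def image_iff elim!: oddE)
  ultimately have "jet_sums (\<lambda>n. S' n + T' n) (F + G)"
    by (rule jet_sums_add)
  moreover have "S' n + T' n \<in> jet_terms (V \<union> W)" for n
    using jet_terms_mono[OF S(1), of "V \<union> W"] jet_terms_mono[OF T(1), of "V \<union> W"]
    by (simp add: S'_def T'_def)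
  ultimately show ?thesis
    using VV[OF \<open>V \<in> VV\<close> \<open>W \<in> VV\<close>] unfolding jet_algebra_def jet_series_def by blast
qed

lemma jet_terms_in_jet_algebra:
  assumes "F \<in> jet_terms V" "V \<in> VV"
  shows "F \<in> jet_algebra VV"
proof -
  define T where "T n = (if n = 0 then F else 0)" for n :: nat
  \<comment> \<open>Position 0 counts only at those \<open>m\<close> where the coefficient of
    \<open>F\<close> does not vanish.\<close>
  have "{n. T n m \<noteq> 0} = (if F m = 0 then {} else {0})" for m
    by (auto simp: T_def)
  then have "jet_sums T F"
    by (simp add: jet_sums_def T_def)
  moreover have "T \<in> jet_series VV"
    using assms zero_in_jet_terms by (auto simp: jet_series_def T_def)
  ultimately show ?thesis
    by (auto simp: jet_algebra_def)
qed

lemma jet_var_in_jet_algebra: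
  assumes "\<And>J. {J} \<in> VV"
  shows "jet_var J \<in> jet_algebra VV"
  using jet_terms_in_jet_algebra[OF jet_terms.var assms] by blast

lemma characteristic_derivative_add:
  assumes VV: "\<And>V W. V \<in> VV \<Longrightarrow> W \<in> VV \<Longrightarrow> V \<union> W \<in> VV"
    and D: "\<And>i. linear_operator VV (D i)"
    and 1: "characteristic_derivative VV D Q1 \<Delta>1"
    and 2: "characteristic_derivative VV D Q2 \<Delta>2"
  shows "characteristic_derivative VV D (Q1 + Q2) (\<lambda>F. \<Delta>1 F + \<Delta>2 F)"
  unfolding characteristic_derivative_def
proof (intro conjI)
  note lin = 1[unfolded characteristic_derivative_def linear_operator_def]
    2[unfolded characteristic_derivative_def linear_operator_def]
  \<comment> \<open>That the values stay in the algebra is where interleaving enters.\<close>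
  show "linear_operator VV (\<lambda>F. \<Delta>1 F + \<Delta>2 F)"
    using lin by (simp add: linear_operator_def jet_algebra_add[OF VV] jet_scale_add ac_simps)
  show "acts_termwise VV (\<lambda>F. \<Delta>1 F + \<Delta>2 F)"
    using 1 2 by (auto simp: characteristic_derivative_def acts_termwise_def intro!: jet_sums_add)
  show "\<forall>f. smooth f \<longrightarrow> \<Delta>1 (jet_base f) + \<Delta>2 (jet_base f) = 0"
    "\<Delta>1 (jet_var {#}) + \<Delta>2 (jet_var {#}) = Q1 + Q2"
    using 1 2 by (simp_all add: characteristic_derivative_def)
  \<comment> \<open>Additivity of \<open>D i\<close> is available on the algebra only;
    \<open>lin\<close> places \<open>\<Delta>1 F\<close> and \<open>\<Delta>2 F\<close>
    there.\<close>
  show "\<forall>i. \<forall>F\<in>jet_algebra VV. \<Delta>1 (D i F) + \<Delta>2 (D i F) = D i (\<Delta>1 F + \<Delta>2 F)"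
    using D lin by (simp add: linear_operator_def)
  show "leibniz VV (\<lambda>F. \<Delta>1 F + \<Delta>2 F)"
    using 1 2 by (simp add: characteristic_derivative_def leibniz_def jet_mult_add_left
        jet_mult_add_right ac_simps)
qed

text \<open>This turns the sum from one operator with the right properties into the operator
  determined by its characteristic. Agreement is claimed on the algebra because the defining
  conditions do not constrain values outside it.\<close>

lemma characteristic_derivative_unique:
  assumes sing: "\<And>J. {J} \<in> VV"
    and D: "\<And>i J. D i (jet_var J) = jet_var (add_mset i J)"
    and 1: "characteristic_derivative VV D Q \<Delta>"
    and 2: "characteristic_derivative VV D Q \<Delta>'"
    and F: "F \<in> jet_algebra VV"
  shows "\<Delta> F = \<Delta>' F"
proof -
  note props = 1[unfolded characteristic_derivative_def] 2[unfolded characteristic_derivative_def]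
  have var: "\<Delta> (jet_var J) = \<Delta>' (jet_var J)" for J
  proof (induction J)
    case empty
    show ?case
      using props by simp
  next
    case (add i J)
    \<comment> \<open>The variable for \<open>add_mset i J\<close> is \<open>D i\<close> of the one
      for \<open>J\<close>, so commutation reduces its image to the induction hypothesis.\<close>
    have "\<Delta> (D i (jet_var J)) = D i (\<Delta> (jet_var J))" "\<Delta>' (D i (jet_var J)) = D i (\<Delta>' (jet_var J))"
      using props jet_var_in_jet_algebra[OF sing] by blast+
    then show ?case
      using add by (simp add: D)
  qed
  have terms: "\<Delta> G = \<Delta>' G" if "G \<in> jet_terms V" "V \<in> VV" for G V
    using that
  proof (induction rule: jet_terms.induct)
    case (base f)
    then show ?case
      using props by simp
  next
    case (var J)
    show ?case
      by (rule \<open>\<And>J. \<Delta> (jet_var J) = \<Delta>' (jet_var J)\<close>)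
  next
    case (mult G H)
    \<comment> \<open>The Leibniz rule holds for factors in the algebra; both factors are terms over
      the same \<open>V\<close>, hence one-term series.\<close>
    then have "G \<in> jet_algebra VV" "H \<in> jet_algebra VV"
      by (auto intro: jet_terms_in_jet_algebra)
    then show ?case
      using props mult by (simp add: leibniz_def)
  qed
  obtain T where T: "T \<in> jet_series VV" "jet_sums T F"
    using F by (auto simp: jet_algebra_def)
  then have "\<Delta> (T n) = \<Delta>' (T n)" for n
    using terms by (auto simp: jet_series_def)
  \<comment> \<open>Both image series have the same terms, and the coefficientwise finite sum of a
    series is unique.\<close>
  moreover have "jet_sums (\<lambda>n. \<Delta> (T n)) (\<Delta> F)" "jet_sums (\<lambda>n. \<Delta>' (T n)) (\<Delta>' F)"
    using T props by (auto simp: acts_termwise_def)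
  ultimately show ?thesis
    by (simp add: jet_sums_unique)
qed

theorem proposition2:
  fixes VV :: "'i::countable multiset set set"
    and D :: "'i \<Rightarrow> ('i, 'k::real_normed_field, 'n::finite) jet_op"
    and \<Delta>1 \<Delta>2 :: "('i, 'k, 'n) jet_op"
    and Q1 Q2 :: "('i, 'k, 'n) jet_fun"
  assumes "VV = UNIV \<or> VV = Collect finite"
    and "\<And>i. total_derivative VV i (D i)"
    and "Q1 \<in> jet_algebra VV" and "Q2 \<in> jet_algebra VV"
    and "characteristic_derivative VV D Q1 \<Delta>1"
    and "characteristic_derivative VV D Q2 \<Delta>2"
  shows "characteristic_derivative VV D (Q1 + Q2) (\<lambda>F. \<Delta>1 F + \<Delta>2 F) \<and>
    (\<forall>\<Delta>. characteristic_derivative VV D (Q1 + Q2) \<Delta> \<longrightarrow>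
      (\<forall>F\<in>jet_algebra VV. \<Delta>1 F + \<Delta>2 F = \<Delta> F))"
proof -
  \<comment> \<open>Both choices of \<open>VV\<close> enter through two closure facts: unions give
    two series a common set of variables, and singletons put each variable into the algebra.\<close>
  have VV: "V \<union> W \<in> VV" if "V \<in> VV" "W \<in> VV" for V W
    using assms(1) that by auto
  have sing: "{J} \<in> VV" for J
    using assms(1) by auto
  have D: "linear_operator VV (D i)" "D i (jet_var J) = jet_var (add_mset i J)" for i J
    using assms(2)[of i] by (auto simp: total_derivative_def)
  have sum: "characteristic_derivative VV D (Q1 + Q2) (\<lambda>F. \<Delta>1 F + \<Delta>2 F)"
    using VV D(1) assms(5,6) by (rule characteristic_derivative_add)
  then show ?thesis
    using characteristic_derivative_unique[where D = D, OF sing D(2) sum] by blast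
qed

end
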